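(* Let $n\ge1$ and $\sigma>0$. The Fourier transform $\widehat{\Phi_\sigma}$ of the texture kernel $\Phi_\sigma=\sigma\Delta\gamma_\sigma$ on $\mathbb{R}^n$ satisfies: 1. $\widehat{\Phi_\sigma}(0)=0$. 2. $\widehat{\Phi_\sigma}(\xi)<0$ for every $\xi\ne0$, and the unique zero is at $\xi=0$. 3. The global minimum of $\widehat{\Phi_\sigma}$ is attained exactly at the frequencies with $|\xi|=\sqrt2/\sigma$ (i.e. as a function of $|\xi|$, $\widehat{\Phi_\sigma}$ has a unique global minimizer, $|\xi|_{\min}=\sqrt2/\sigma$). 4. $\lim_{|\xi|\to\infty}\widehat{\Phi_\sigma}(\xi)=0$.
   Context: $\gamma_\sigma(x)=(2\pi\sigma^2)^{-n/2}\exp(-|x|^2/(2\sigma^2))$ is the Gaussian kernel on $\mathbb{R}^n$, $\Delta$ is the spatial Laplacian, and the Fourier transform is $\hat u(\xi)=\int_{\mathbb{R}^n}u(x)e^{-ix\cdot\xi}\,dx$. *)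

theory Defs
  imports "HOL-Analysis.Analysis"
begin

definition gauss_kernel :: "real \<Rightarrow> real ^ 'n \<Rightarrow> real" where
  "gauss_kernel \<sigma> x =
     (2 * pi * \<sigma>\<^sup>2) powr (- real CARD('n) / 2) * exp (- (norm x)\<^sup>2 / (2 * \<sigma>\<^sup>2))"

definition partial_deriv :: "'n \<Rightarrow> (real ^ 'n \<Rightarrow> real) \<Rightarrow> real ^ 'n \<Rightarrow> real" where
  "partial_deriv i f x = deriv (\<lambda>t. f (x + t *\<^sub>R axis i 1)) 0"

definition laplacian :: "(real ^ 'n \<Rightarrow> real) \<Rightarrow> real ^ 'n \<Rightarrow> real" where
  "laplacian f x = (\<Sum>i\<in>UNIV. partial_deriv i (partial_deriv i f) x)"

definition fourier_transform :: "(real ^ 'n \<Rightarrow> complex) \<Rightarrow> real ^ 'n \<Rightarrow> complex" where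
  "fourier_transform u \<xi> = (LINT x|lborel. u x * exp (- (\<i> * complex_of_real (x \<bullet> \<xi>))))"

definition texture_kernel :: "real \<Rightarrow> real ^ 'n \<Rightarrow> real" where
  "texture_kernel \<sigma> x = \<sigma> * laplacian (gauss_kernel \<sigma>) x"

definition texture_kernel_ft :: "real \<Rightarrow> real ^ 'n \<Rightarrow> complex" where
  "texture_kernel_ft \<sigma> = fourier_transform (\<lambda>x. complex_of_real (texture_kernel \<sigma> x))"

end

theory Submission
  imports Defs "HOL-Probability.Characteristic_Functions" "HOL-Real_Asymp.Real_Asymp"
begin

text \<open>
  The Laplacian of the Gaussian kernel is a sum of products of one-variable functions, each product
  containing one factor \<open>g''\<close> and otherwise factors \<open>g\<close>, where \<open>g\<close> is the centred normal density.
  By Fubini the Fourier transform reduces to the transforms of \<open>g\<close> and \<open>g''\<close> on the line. The first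
  is a rescaled characteristic function; the second follows because
  \<open>(g'' t + x\<^sup>2 * g t) * exp (- \<i> * t * x)\<close> is the derivative of a function vanishing at both ends.
  The result is \<open>- \<sigma> * r\<^sup>2 * exp (- \<sigma>\<^sup>2 * r\<^sup>2 / 2)\<close> with \<open>r = norm \<xi>\<close>; in terms of
  \<open>u = \<sigma>\<^sup>2 * r\<^sup>2 / 2\<close> this is a negative multiple of \<open>u * exp (- u)\<close>, which is maximal exactly at \<open>u = 1\<close>.
\<close>

section \<open>Fubini for products of one-variable functions\<close>

lemma
  fixes f :: "'a::euclidean_space \<Rightarrow> real \<Rightarrow> complex"
  assumes "\<And>b. b \<in> Basis \<Longrightarrow> integrable lborel (f b)"
  shows integrable_lborel_prod_Basis: "integrable lborel (\<lambda>x. \<Prod>b\<in>Basis. f b (x \<bullet> b))"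
    and integral_lborel_prod_Basis:
      "(LINT x|lborel. (\<Prod>b\<in>Basis. f b (x \<bullet> b))) = (\<Prod>b\<in>Basis. LINT t|lborel. f b t)"
proof -
  interpret product_sigma_finite "\<lambda>_::'a. lborel :: real measure" ..
  have [measurable]: "f b \<in> borel_measurable borel" if "b \<in> Basis" for b
    using borel_measurable_integrable[OF assms[OF that]] by simp
  show "integrable lborel (\<lambda>x. \<Prod>b\<in>Basis. f b (x \<bullet> b))"
    using product_integrable_prod[OF finite_Basis assms]
    \<comment> \<open>\<open>lborel_eq\<close> presents Lebesgue measure as the image of the finite
      product of one-dimensional Lebesgue measures indexed by \<open>Basis\<close>.\<close>
    by (subst lborel_eq) (simp add: integrable_distr_eq)
  show "(LINT x|lborel. (\<Prod>b\<in>Basis. f b (x \<bullet> b))) = (\<Prod>b\<in>Basis. LINT t|lborel. f b t)"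
    using product_integral_prod[OF finite_Basis assms]
    by (subst (1) lborel_eq) (simp add: integral_distr)
qed

lemma
  fixes f :: "'n::finite \<Rightarrow> real \<Rightarrow> complex"
  assumes "\<And>i. integrable lborel (f i)"
  shows integrable_lborel_prod_vec: "integrable lborel (\<lambda>x::real ^ 'n. \<Prod>i\<in>UNIV. f i (x $ i))"
    and integral_lborel_prod_vec:
      "(LINT x|lborel. (\<Prod>i\<in>UNIV. f i ((x::real ^ 'n) $ i))) = (\<Prod>i\<in>UNIV. LINT t|lborel. f i t)"
proof -
  have Basis_eq: "(Basis :: (real ^ 'n) set) = range (\<lambda>i. axis i 1)"
    by (auto simp: Basis_vec_def)
  have inj: "inj (\<lambda>i::'n. axis i (1::real))"
    by (auto simp: inj_def axis_eq_axis)
  \<comment> \<open>Reindexes the family from coordinates to basis vectors. Off the range of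
    \<open>axis\<close> the inverse is arbitrary, but \<open>g b\<close> is still some member of
    \<open>f\<close>, hence integrable.\<close>
  define g where "g b = f (inv (\<lambda>i. axis i (1::real)) b)" for b
  have g: "g (axis i 1) = f i" for i
    using inv_f_f[OF inj] by (simp add: g_def)
  have "integrable lborel (g b)" for b
    by (simp add: g_def assms)
  note * = integrable_lborel_prod_Basis[where f=g, OF this] integral_lborel_prod_Basis[where f=g, OF this]
  show "integrable lborel (\<lambda>x::real ^ 'n. \<Prod>i\<in>UNIV. f i (x $ i))"
    using *(1) by (simp add: Basis_eq prod.reindex[OF inj] g inner_axis)
  show "(LINT x|lborel. (\<Prod>i\<in>UNIV. f i ((x::real ^ 'n) $ i))) = (\<Prod>i\<in>UNIV. LINT t|lborel. f i t)"
    using *(2) by (simp add: Basis_eq prod.reindex[OF inj] g inner_axis)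
qed

section \<open>One-dimensional transforms of the normal density and its second derivative\<close>

lemma integral_lborel_derivative_eq_0:
  fixes F f :: "real \<Rightarrow> 'a::euclidean_space"
  assumes "\<And>x. (F has_vector_derivative f x) (at x)"
    and "\<And>x. isCont f x"
    and "integrable lborel f"
    and "(F \<longlongrightarrow> 0) at_bot" "(F \<longlongrightarrow> 0) at_top"
  shows "integral\<^sup>L lborel f = 0"
proof -
  have "(LBINT x=-\<infinity>..\<infinity>. f x) = 0 - 0"
    using assms
    by (intro interval_integral_FTC_integrable[where F=F])
       (auto simp: ereal_tendsto_simps set_integrable_def einterval_def)
  then show ?thesis
    by (simp add: interval_lebesgue_integral_def set_lebesgue_integral_def einterval_def)
qed

text \<open>The second derivative of \<open>normal_density 0 \<sigma>\<close> in closed form, which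
  makes its integrability a matter of Gaussian moments.\<close>

definition normal_density'' :: "real \<Rightarrow> real \<Rightarrow> real" where
  "normal_density'' \<sigma> t = normal_density 0 \<sigma> t * (t\<^sup>2 / \<sigma> ^ 4 - 1 / \<sigma>\<^sup>2)"

lemma norm_exp_neg_ii [simp]: "norm (exp (- (\<i> * complex_of_real a))) = 1"
  using norm_exp_i_times[of "- a"] by simp

lemma integrable_mult_exp_neg_ii:
  fixes f :: "real \<Rightarrow> real"
  assumes "integrable lborel f"
  shows "integrable lborel (\<lambda>t. complex_of_real (f t) * exp (- (\<i> * complex_of_real (t * x))))"
proof (rule Bochner_Integration.integrable_bound)
  show "integrable lborel f" by fact
  show "(\<lambda>t. complex_of_real (f t) * exp (- (\<i> * complex_of_real (t * x)))) \<in> borel_measurable lborel"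
    using borel_measurable_integrable[OF assms] by measurable
qed (simp add: norm_mult)

lemma integrable_normal_density'':
  assumes "\<sigma> > 0"
  shows "integrable lborel (normal_density'' \<sigma>)"
proof -
  have "integrable lborel (\<lambda>t. normal_density 0 \<sigma> t * (t - 0) ^ 2 * (1 / \<sigma> ^ 4)
      - normal_density 0 \<sigma> t * (1 / \<sigma>\<^sup>2))"
    using assms
    by (intro Bochner_Integration.integrable_diff integrable_mult_left
        integrable_normal_moment integrable_normal_density)
  then show ?thesis
    by (simp add: normal_density''_def[abs_def] algebra_simps)
qed

lemma fourier_normal_density:
  assumes "\<sigma> > 0"
  shows "(LINT t|lborel. complex_of_real (normal_density 0 \<sigma> t) * exp (- (\<i> * complex_of_real (t * x))))
    = exp (- (\<sigma>\<^sup>2 * x\<^sup>2 / 2))"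
proof -
  \<comment> \<open>\<open>char\<close> integrates against \<open>iexp\<close> with a positive sign,
    so it is evaluated at a negative multiple of \<open>x\<close>; the factor
    \<open>\<sigma>\<close> rescales the standard normal.\<close>
  have "complex_of_real (exp (- (- \<sigma> * x)\<^sup>2 / 2)) = char std_normal_distribution (- \<sigma> * x)"
    by (simp add: char_std_normal_distribution)
  also have "\<dots> = (LINT t|lborel. std_normal_density t *\<^sub>R iexp (- \<sigma> * x * t))"
    unfolding char_def by (subst integral_density) auto
  \<comment> \<open>The outer \<open>\<sigma>\<close> is the Jacobian of the substitution, and
    \<open>0 + \<sigma> * t\<close> is the shape expected by
    \<open>lborel_integral_real_affine\<close>.\<close>
  also have "\<dots> = (LINT t|lborel. \<sigma> *\<^sub>R (complex_of_real (normal_density 0 \<sigma> (0 + \<sigma> * t))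
      * exp (- (\<i> * complex_of_real ((0 + \<sigma> * t) * x)))))"
    using assms
    by (intro Bochner_Integration.integral_cong)
       (auto simp: normal_density_def scaleR_conv_of_real real_sqrt_mult field_simps)
  also have "\<dots> = (LINT t|lborel. complex_of_real (normal_density 0 \<sigma> t) * exp (- (\<i> * complex_of_real (t * x))))"
    using assms
    by (subst (2) lborel_integral_real_affine[of \<sigma> _ 0]) auto
  finally show ?thesis
    by (simp add: power_mult_distrib flip: exp_of_real)
qed

lemma fourier_normal_density'':
  assumes "\<sigma> > 0"
  shows "(LINT t|lborel. complex_of_real (normal_density'' \<sigma> t) * exp (- (\<i> * complex_of_real (t * x))))
    = - (x\<^sup>2) * exp (- (\<sigma>\<^sup>2 * x\<^sup>2 / 2))"
proof -
  let ?e = "\<lambda>t. exp (- (\<i> * complex_of_real (t * x)))"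
  let ?g = "normal_density 0 \<sigma>"
  \<comment> \<open>Since g' = - t / \<sigma>^2 * g, this is (g' + i x g) e with e = exp(- i t x).
    In its derivative the terms i x g' cancel and (g'' + x^2 g) e remains, which is
    \<open>f\<close>.\<close>
  define F where "F t = complex_of_real (?g t) * (\<i> * x - t / \<sigma>\<^sup>2) * ?e t" for t
  define f where "f t = complex_of_real (normal_density'' \<sigma> t) * ?e t
      + x\<^sup>2 * (complex_of_real (?g t) * ?e t)" for t
  have int: "integrable lborel (\<lambda>t. complex_of_real (normal_density'' \<sigma> t) * ?e t)"
      "integrable lborel (\<lambda>t. complex_of_real (?g t) * ?e t)"
    using assms
    by (intro integrable_mult_exp_neg_ii integrable_normal_density'' integrable_normal_density; simp)+
  \<comment> \<open>A real majorant of \<open>norm (F t)\<close>: Gaussian decay beats linear growth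
    at both ends.\<close>
  have g_bound: "((\<lambda>t. ?g t * (\<bar>x\<bar> + \<bar>t\<bar> / \<sigma>\<^sup>2)) \<longlongrightarrow> 0) at_top"
      "((\<lambda>t. ?g t * (\<bar>x\<bar> + \<bar>t\<bar> / \<sigma>\<^sup>2)) \<longlongrightarrow> 0) at_bot"
    unfolding normal_density_def using assms by real_asymp+
  have F_le: "norm (F t) \<le> ?g t * (\<bar>x\<bar> + \<bar>t\<bar> / \<sigma>\<^sup>2)" for t
  proof -
    have "norm (\<i> * complex_of_real x - complex_of_real t / complex_of_real (\<sigma>\<^sup>2)) \<le> \<bar>x\<bar> + \<bar>t\<bar> / \<sigma>\<^sup>2"
      by (rule order_trans[OF norm_triangle_ineq4]) (simp add: norm_mult norm_divide norm_power)
    then show ?thesis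
      by (simp add: F_def norm_mult mult_left_mono)
  qed
  have f_0: "integral\<^sup>L lborel f = 0"
  proof (rule integral_lborel_derivative_eq_0[where F=F])
    have g': "(?g has_real_derivative ?g t * (- t / \<sigma>\<^sup>2)) (at t)" for t
      unfolding normal_density_def using assms
      by (auto intro!: derivative_eq_intros simp: field_simps)
    have g'': "((\<lambda>t. complex_of_real (?g t)) has_vector_derivative complex_of_real (?g t * (- t / \<sigma>\<^sup>2))) (at t)" for t
      using g' by (intro has_vector_derivative_of_real) (simp add: has_real_derivative_iff_has_vector_derivative)
    \<comment> \<open>The cofactor of \<open>?g\<close> in \<open>F\<close> extends to an entire
      function, so ordinary complex differentiation applies before restricting to the real
      line.\<close>
    define G where "G z = (\<i> * x - z / \<sigma>\<^sup>2) * exp (- (\<i> * (z * x)))" for z :: complex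
    define G' where "G' z = (- 1 / \<sigma>\<^sup>2 - \<i> * x * (\<i> * x - z / \<sigma>\<^sup>2)) * exp (- (\<i> * (z * x)))" for z :: complex
    have "(G has_field_derivative G' z) (at z)" for z
      unfolding G_def[abs_def] G'_def using assms
      by (auto intro!: derivative_eq_intros simp: field_simps power2_eq_square power4_eq_xxxx)
    then have "((\<lambda>t. G (complex_of_real t)) has_vector_derivative G' (complex_of_real t)) (at t)" for t
      by (intro has_vector_derivative_real_field)
    from has_vector_derivative_mult[OF g'' this]
    have "((\<lambda>t. complex_of_real (?g t) * G t) has_vector_derivative
        complex_of_real (?g t) * G' t + complex_of_real (?g t * (- t / \<sigma>\<^sup>2)) * G t) (at t)" for t .
    moreover have "complex_of_real (?g t) * G' t + complex_of_real (?g t * (- t / \<sigma>\<^sup>2)) * G t = f t" for t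
      using assms by (simp add: f_def G_def G'_def normal_density''_def field_simps power2_eq_square power4_eq_xxxx)
    moreover have "F = (\<lambda>t. complex_of_real (?g t) * G t)"
      by (simp add: F_def G_def fun_eq_iff)
    ultimately show "(F has_vector_derivative f t) (at t)" for t
      by simp
    show "isCont f t" for t
      unfolding f_def normal_density''_def normal_density_def using assms
      by (intro continuous_intros) auto
    show "integrable lborel f"
      unfolding f_def using int by auto
    show "(F \<longlongrightarrow> 0) at_bot" "(F \<longlongrightarrow> 0) at_top"
      by (rule Lim_null_comparison[OF always_eventually g_bound(2)] Lim_null_comparison[OF always_eventually g_bound(1)], simp add: F_le)+
  qed
  have "integral\<^sup>L lborel f = (LINT t|lborel. complex_of_real (normal_density'' \<sigma> t) * ?e t)
      + x\<^sup>2 * (LINT t|lborel. complex_of_real (?g t) * ?e t)"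
    unfolding f_def using int
    by (subst Bochner_Integration.integral_add) (simp_all del: of_real_mult)
  then show ?thesis
    unfolding f_0 fourier_normal_density[OF assms] by (simp add: eq_neg_iff_add_eq_0)
qed

section \<open>The Laplacian of the Gaussian kernel\<close>

lemma gauss_kernel_eq_prod:
  assumes "\<sigma> > 0"
  shows "gauss_kernel \<sigma> (x :: real ^ 'n) = (\<Prod>i\<in>UNIV. normal_density 0 \<sigma> (x $ i))"
proof -
  let ?c = "2 * pi * \<sigma>\<^sup>2"
  have c: "?c > 0" using assms by simp
  have "(1 / sqrt ?c) ^ CARD('n) = (?c powr (- (1/2))) ^ CARD('n)"
    using c by (simp add: powr_minus powr_half_sqrt inverse_eq_divide)
  also have "\<dots> = ?c powr (- real CARD('n) / 2)"
    by (simp add: powr_powr flip: powr_realpow')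
  finally have c_pow: "?c powr (- real CARD('n) / 2) = (1 / sqrt ?c) ^ CARD('n)" ..
  have "(norm x)\<^sup>2 = (\<Sum>i\<in>UNIV. (x $ i)\<^sup>2)"
    unfolding power2_norm_eq_inner by (simp add: inner_vec_def power2_eq_square)
  then have "exp (- (norm x)\<^sup>2 / (2 * \<sigma>\<^sup>2)) = (\<Prod>i\<in>UNIV. exp (- (x $ i)\<^sup>2 / (2 * \<sigma>\<^sup>2)))"
    by (simp add: exp_sum[symmetric] sum_negf sum_divide_distrib)
  then show ?thesis
    unfolding gauss_kernel_def c_pow by (simp add: normal_density_def prod.distrib prod_dividef power_one_over)
qed

text \<open>Expanding the squared norm along a coordinate direction leaves a one-variable
  exponential in \<open>t\<close>, so both partial derivatives become one-variable computations at
  0.\<close>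

lemma gauss_kernel_line:
  "gauss_kernel \<sigma> (x + t *\<^sub>R axis i 1) =
    gauss_kernel \<sigma> x * exp (- (2 * t * x $ i + t\<^sup>2) / (2 * \<sigma>\<^sup>2))"
proof -
  have "(norm (x + t *\<^sub>R axis i 1))\<^sup>2 = (norm x)\<^sup>2 + (2 * t * x $ i + t\<^sup>2)"
    unfolding power2_norm_eq_inner
    by (simp add: inner_simps inner_axis inner_axis' axis_nth power2_eq_square algebra_simps)
  then show ?thesis
    by (simp add: gauss_kernel_def mult_exp_exp add_divide_distrib diff_divide_distrib)
qed

lemma partial_deriv_gauss_kernel:
  assumes "\<sigma> > 0"
  shows "partial_deriv i (gauss_kernel \<sigma>) x = - (x $ i / \<sigma>\<^sup>2) * gauss_kernel \<sigma> x"
  unfolding partial_deriv_def gauss_kernel_line using assms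
  by (intro DERIV_imp_deriv) (auto intro!: derivative_eq_intros simp: field_simps)

lemma partial_deriv2_gauss_kernel:
  assumes "\<sigma> > 0"
  shows "partial_deriv i (partial_deriv i (gauss_kernel \<sigma>)) x =
    (x $ i ^ 2 / \<sigma> ^ 4 - 1 / \<sigma>\<^sup>2) * gauss_kernel \<sigma> x"
  \<comment> \<open>Only the outer derivative is unfolded; the inner one is replaced by its closed
    form at every point of the line.\<close>
  unfolding partial_deriv_def[of i "partial_deriv i (gauss_kernel \<sigma>)"]
    partial_deriv_gauss_kernel[OF assms] gauss_kernel_line using assms
  by (intro DERIV_imp_deriv)
     (auto intro!: derivative_eq_intros simp: field_simps axis_def power2_eq_square power4_eq_xxxx)

lemma laplacian_gauss_kernel:
  assumes "\<sigma> > 0"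
  shows "laplacian (gauss_kernel \<sigma>) x =
    (\<Sum>i\<in>UNIV. \<Prod>j\<in>UNIV. (if j = i then normal_density'' \<sigma> else normal_density 0 \<sigma>) (x $ j))"
  unfolding laplacian_def
proof (rule sum.cong[OF refl])
  fix i
  \<comment> \<open>The polynomial factor of g'' is split off; it occurs only at
    \<open>j = i\<close>, and the remaining densities reassemble to the kernel.\<close>
  have "(\<Prod>j\<in>UNIV. (if j = i then normal_density'' \<sigma> else normal_density 0 \<sigma>) (x $ j)) =
    (\<Prod>j\<in>UNIV. (if j = i then x $ j ^ 2 / \<sigma> ^ 4 - 1 / \<sigma>\<^sup>2 else 1) * normal_density 0 \<sigma> (x $ j))"
    by (intro prod.cong) (auto simp: normal_density''_def)
  also have "\<dots> = (x $ i ^ 2 / \<sigma> ^ 4 - 1 / \<sigma>\<^sup>2) * gauss_kernel \<sigma> x"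
    by (simp add: prod.distrib gauss_kernel_eq_prod[OF assms])
  finally show "partial_deriv i (partial_deriv i (gauss_kernel \<sigma>)) x =
      (\<Prod>j\<in>UNIV. (if j = i then normal_density'' \<sigma> else normal_density 0 \<sigma>) (x $ j))"
    by (simp add: partial_deriv2_gauss_kernel[OF assms])
qed

section \<open>Closed form of the transform\<close>

definition texture_profile :: "real \<Rightarrow> real \<Rightarrow> real" where
  "texture_profile \<sigma> r = - \<sigma> * r\<^sup>2 * exp (- (\<sigma>\<^sup>2 * r\<^sup>2 / 2))"

lemma texture_kernel_ft_eq:
  fixes \<xi> :: "real ^ 'n"
  assumes "\<sigma> > 0"
  shows "texture_kernel_ft \<sigma> \<xi> = complex_of_real (texture_profile \<sigma> (norm \<xi>))"
proof -
  let ?h = "\<lambda>i j. if j = i then normal_density'' \<sigma> else normal_density 0 \<sigma>"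
  let ?k = "\<lambda>i j t. complex_of_real (?h i j t) * exp (- (\<i> * complex_of_real (t * \<xi> $ j)))"
  let ?E = "\<lambda>j. complex_of_real (exp (- (\<sigma>\<^sup>2 * (\<xi> $ j)\<^sup>2 / 2)))"
  have norm2: "(norm \<xi>)\<^sup>2 = (\<Sum>i\<in>UNIV. (\<xi> $ i)\<^sup>2)"
    unfolding power2_norm_eq_inner by (simp add: inner_vec_def power2_eq_square)
  have int: "integrable lborel (?k i j)" for i j
    using assms integrable_normal_density''
    by (intro integrable_mult_exp_neg_ii) auto
  have "exp (- (\<i> * complex_of_real (x \<bullet> \<xi>))) = (\<Prod>j\<in>UNIV. exp (- (\<i> * complex_of_real (x $ j * \<xi> $ j))))" for x
    by (simp add: exp_sum[symmetric] inner_vec_def sum_negf sum_distrib_left)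
  then have integrand: "complex_of_real (texture_kernel \<sigma> x) * exp (- (\<i> * complex_of_real (x \<bullet> \<xi>)))
      = \<sigma> * (\<Sum>i\<in>UNIV. \<Prod>j\<in>UNIV. ?k i j (x $ j))" for x
    by (simp add: texture_kernel_def laplacian_gauss_kernel[OF assms] prod.distrib sum_distrib_right mult.assoc)
  have "texture_kernel_ft \<sigma> \<xi> = \<sigma> * (\<Sum>i\<in>UNIV. LINT x|lborel. (\<Prod>j\<in>UNIV. ?k i j (x $ j)))"
    unfolding texture_kernel_ft_def fourier_transform_def integrand
    using integrable_lborel_prod_vec[OF int]
    by (subst integral_mult_right_zero, subst Bochner_Integration.integral_sum) auto
  also have "\<dots> = \<sigma> * (\<Sum>i\<in>UNIV. \<Prod>j\<in>UNIV. LINT t|lborel. ?k i j t)"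
    by (simp only: integral_lborel_prod_vec[OF int])
  \<comment> \<open>Both one-dimensional transforms contain the same exponential
    \<open>?E j\<close>; only the factor at \<open>j = i\<close> carries an extra - (\<xi>_j)^2. The
    sum over \<open>i\<close> then produces the squared norm.\<close>
  also have "\<dots> = \<sigma> * (\<Sum>i\<in>UNIV. \<Prod>j\<in>UNIV. (if j = i then complex_of_real (- (\<xi> $ j)\<^sup>2) else 1) * ?E j)"
    using fourier_normal_density[OF assms] fourier_normal_density''[OF assms]
    by (intro arg_cong2[where f="(*)"] sum.cong prod.cong refl) auto
  also have "\<dots> = \<sigma> * (\<Sum>i\<in>UNIV. complex_of_real (- (\<xi> $ i)\<^sup>2) * (\<Prod>j\<in>UNIV. ?E j))"
    by (simp add: prod.distrib)
  also have "\<dots> = \<sigma> * complex_of_real (- (norm \<xi>)\<^sup>2) * (\<Prod>j\<in>UNIV. ?E j)"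
    by (simp add: norm2 sum_distrib_right sum_negf)
  also have "(\<Prod>j\<in>UNIV. ?E j) = complex_of_real (exp (- (\<sigma>\<^sup>2 * (norm \<xi>)\<^sup>2 / 2)))"
    by (simp add: norm2 exp_sum[symmetric] sum_negf sum_distrib_left sum_divide_distrib
        flip: of_real_prod)
  finally show ?thesis
    by (simp add: texture_profile_def)
qed

section \<open>Sign, minimum and decay of the radial profile\<close>

lemma texture_profile_neg_iff:
  assumes "\<sigma> > 0"
  shows "texture_profile \<sigma> r < 0 \<longleftrightarrow> r \<noteq> 0"
  using assms by (simp add: texture_profile_def zero_less_mult_iff)

text \<open>Exponentiates ln u <= u - 1, where equality holds only at u = 1. The case u = 0 is
  separate because the logarithm bound needs u > 0.\<close>

lemma mult_exp_minus_less:
  fixes u :: real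
  assumes "u \<ge> 0" "u \<noteq> 1"
  shows "u * exp (- u) < exp (- 1)"
proof (cases "u = 0")
  case False
  then have "ln u < u - 1"
    using assms ln_le_minus_one[of u] ln_eq_minus_one[of u] by force
  then have "u < exp (u - 1)"
    using assms False by (metis exp_less_cancel_iff exp_ln less_eq_real_def)
  then have "u * exp (- u) < exp (u - 1) * exp (- u)"
    by simp
  then show ?thesis
    by (simp add: mult_exp_exp)
qed simp

lemma texture_profile_minimum:
  assumes "\<sigma> > 0" "r \<ge> 0" "r \<noteq> sqrt 2 / \<sigma>"
  shows "texture_profile \<sigma> (sqrt 2 / \<sigma>) < texture_profile \<sigma> r"
proof -
  \<comment> \<open>Substituting u = \<sigma>^2 s^2 / 2 turns \<sigma> s^2 into (2 / \<sigma>) u;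
    the negative constant turns the strict maximum of u exp(- u) into a strict minimum.\<close>
  have eq: "texture_profile \<sigma> s = - (2 / \<sigma>) * (\<sigma>\<^sup>2 * s\<^sup>2 / 2 * exp (- (\<sigma>\<^sup>2 * s\<^sup>2 / 2)))" for s
    using assms by (simp add: texture_profile_def power2_eq_square)
  have "\<sigma>\<^sup>2 * (sqrt 2 / \<sigma>)\<^sup>2 / 2 = 1"
    using assms by (simp add: power_divide)
  then have min: "texture_profile \<sigma> (sqrt 2 / \<sigma>) = - (2 / \<sigma>) * exp (- 1)"
    by (simp only: eq mult_1)
  \<comment> \<open>Squaring is injective on nonnegative reals, so u = 1 singles out one
    radius.\<close>
  have "\<sigma>\<^sup>2 * r\<^sup>2 / 2 \<noteq> 1"
  proof
    assume "\<sigma>\<^sup>2 * r\<^sup>2 / 2 = 1"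
    then have "(\<sigma> * r)\<^sup>2 = 2" by (simp add: power_mult_distrib)
    then have "\<sigma> * r = sqrt 2" using assms by (metis less_imp_le mult_nonneg_nonneg real_sqrt_unique)
    then show False using assms by (simp add: field_simps)
  qed
  then show ?thesis
    unfolding min eq[of r] using assms mult_exp_minus_less[of "\<sigma>\<^sup>2 * r\<^sup>2 / 2"]
    by (intro mult_strict_left_mono_neg) auto
qed

lemma texture_profile_tendsto_0:
  assumes "\<sigma> > 0"
  shows "(texture_profile \<sigma> \<longlongrightarrow> 0) at_top"
  unfolding texture_profile_def using assms by real_asymp

text \<open>The transform is complex-valued, so negativity is stated as being real with negative
  real part, and minimality compares real parts.\<close>

theorem theorem3p4:
  fixes \<sigma> :: real
  assumes "\<sigma> > 0"
  shows "texture_kernel_ft \<sigma> (0 :: real ^ 'n) = 0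
    \<and> (\<forall>\<xi> :: real ^ 'n. \<xi> \<noteq> 0 \<longrightarrow>
          texture_kernel_ft \<sigma> \<xi> \<in> \<real> \<and> Re (texture_kernel_ft \<sigma> \<xi>) < 0)
    \<and> (\<forall>\<xi> :: real ^ 'n. texture_kernel_ft \<sigma> \<xi> = 0 \<longleftrightarrow> \<xi> = 0)
    \<and> (\<forall>\<xi> :: real ^ 'n.
          (\<forall>\<eta> :: real ^ 'n. Re (texture_kernel_ft \<sigma> \<xi>) \<le> Re (texture_kernel_ft \<sigma> \<eta>))
            \<longleftrightarrow> norm \<xi> = sqrt 2 / \<sigma>)
    \<and> (\<exists>g :: real \<Rightarrow> real.
          (\<forall>\<xi> :: real ^ 'n. texture_kernel_ft \<sigma> \<xi> = complex_of_real (g (norm \<xi>)))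
          \<and> (\<forall>r\<ge>0. (\<forall>s\<ge>0. g r \<le> g s) \<longleftrightarrow> r = sqrt 2 / \<sigma>))
    \<and> ((texture_kernel_ft \<sigma> :: real ^ 'n \<Rightarrow> complex) \<longlongrightarrow> 0) at_infinity"
proof -
  note ft = texture_kernel_ft_eq[OF assms]
  note neg = texture_profile_neg_iff[OF assms]
  note min = texture_profile_minimum[OF assms]
  have min_pos: "sqrt 2 / \<sigma> \<ge> 0"
    using assms by simp
  have zero: "texture_profile \<sigma> r = 0 \<longleftrightarrow> r = 0" for r
    using neg[of r] by (auto simp: texture_profile_def)
  have min_le: "texture_profile \<sigma> (sqrt 2 / \<sigma>) \<le> texture_profile \<sigma> r" if "r \<ge> 0" for r
    using min[OF that] by (cases "r = sqrt 2 / \<sigma>") auto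
  have min_iff: "(\<forall>s\<ge>0. texture_profile \<sigma> r \<le> texture_profile \<sigma> s) \<longleftrightarrow> r = sqrt 2 / \<sigma>" if "r \<ge> 0" for r
    using min_le min[OF that] min_pos by (auto simp: not_le[symmetric])
  \<comment> \<open>Every nonnegative real is the norm of some vector, so minimizing over
    frequencies is the same as minimizing over radii.\<close>
  have all_norm: "(\<forall>\<eta> :: real ^ 'n. P (norm \<eta>)) \<longleftrightarrow> (\<forall>s\<ge>0. P s)" for P
    by (metis norm_ge_zero vector_choose_size)
  have "((\<lambda>\<xi> :: real ^ 'n. texture_profile \<sigma> (norm \<xi>)) \<longlongrightarrow> 0) at_infinity"
    by (rule filterlim_compose[OF texture_profile_tendsto_0[OF assms] filterlim_norm_at_top])
  note tendsto_of_real[OF this]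
  moreover have "texture_kernel_ft \<sigma> = (\<lambda>\<xi> :: real ^ 'n. complex_of_real (texture_profile \<sigma> (norm \<xi>)))"
    by (rule ext) (rule ft)
  ultimately have lim: "((texture_kernel_ft \<sigma> :: real ^ 'n \<Rightarrow> complex) \<longlongrightarrow> 0) at_infinity"
    by simp
  have minimizers: "\<forall>\<xi> :: real ^ 'n.
      (\<forall>\<eta> :: real ^ 'n. Re (texture_kernel_ft \<sigma> \<xi>) \<le> Re (texture_kernel_ft \<sigma> \<eta>))
        \<longleftrightarrow> norm \<xi> = sqrt 2 / \<sigma>"
    using min_iff all_norm[of "\<lambda>s. texture_profile \<sigma> r \<le> texture_profile \<sigma> s" for r] by (simp add: ft)
  \<comment> \<open>The witness is \<open>texture_profile \<sigma>\<close>.\<close>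
  have radial: "\<exists>g. (\<forall>\<xi> :: real ^ 'n. texture_kernel_ft \<sigma> \<xi> = complex_of_real (g (norm \<xi>)))
      \<and> (\<forall>r\<ge>0. (\<forall>s\<ge>0. g r \<le> g s) \<longleftrightarrow> r = sqrt 2 / \<sigma>)"
    using ft min_iff by blast
  show ?thesis
    by (intro conjI minimizers radial lim) (simp_all add: ft neg zero)
qed

end
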